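(* If $\kappa$ is a cardinal number with $2\leq\kappa\leq\mathbf{c}$ and if $\mathbb{P}$ is an uncountable Polish space, then $\mathbb{P}$ can be partitioned into exactly $\kappa$ Bernstein sets such that no member $B$ of the partition is homeomorphic to a subspace of $\mathbb{P}\setminus B$.
   Context: $\mathbf{c}=2^{\aleph_0}$. A Polish space is a separable completely metrizable topological space. A Cantor set is a nonempty totally disconnected compact metrizable space without isolated points, equivalently a space homeomorphic to the Cantor ternary set. A subset $B$ of an uncountable Polish space $\mathbb{P}$ is a Bernstein set if and only if no Cantor set (i.e. no subset of $\mathbb{P}$ which, as a subspace, is a Cantor set) is contained in $B$ or in $\mathbb{P}\setminus B$. *)

theory Defs
  imports "HOL-Analysis.Analysis" "HOL-Library.Disjoint_Sets"
begin

unbundle cardinal_syntax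

definition polish_topology :: "'a topology \<Rightarrow> bool" where
  "polish_topology X \<longleftrightarrow> separable_space X \<and> completely_metrizable_space X"

definition totally_disconnected_space :: "'a topology \<Rightarrow> bool" where
  "totally_disconnected_space X \<longleftrightarrow> (\<forall>S. connectedin X S \<longrightarrow> (\<exists>a. S \<subseteq> {a}))"

definition cantor_space :: "'a topology \<Rightarrow> bool" where
  "cantor_space X \<longleftrightarrow>
     topspace X \<noteq> {} \<and> totally_disconnected_space X \<and> compact_space X \<and>
     metrizable_space X \<and> \<not> (\<exists>x. openin X {x})"

definition cantor_subset :: "'a topology \<Rightarrow> 'a set \<Rightarrow> bool" where
  "cantor_subset X C \<longleftrightarrow> C \<subseteq> topspace X \<and> cantor_space (subtopology X C)"

text \<open>The notion is only meant for an uncountable Polish space \<open>X\<close>.\<close>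

definition bernstein_set :: "'a topology \<Rightarrow> 'a set \<Rightarrow> bool" where
  "bernstein_set X B \<longleftrightarrow>
     B \<subseteq> topspace X \<and>
     \<not> (\<exists>C. cantor_subset X C \<and> (C \<subseteq> B \<or> C \<subseteq> topspace X - B))"

end

(* An embedding h of B into P extends to a closed relation on P: the closure K of its graph
   in P x P still has the single value h x over each x in B. Since P x P has only continuum
   many closed subsets, one transfinite recursion can put, for every such K and every member B
   of the partition, a point x and its only K-value y together into B, while also putting
   a point of every Cantor set into B. No embedding then moves B off itself. *)

theory Submission
  imports Defs
begin

section \<open>Transfinite choice of disjoint finite sets\<close>

lemma lepoll_iff_card_of_ordLeq: "A \<lesssim> B \<longleftrightarrow> |A| \<le>o |B|"
  by (simp add: lepoll_def flip: card_of_ordLeq)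

lemma finite_card_of_ordLess: "finite A \<Longrightarrow> infinite X \<Longrightarrow> |A| <o |X|"
  using finite_ordLess_infinite[OF card_of_Well_order card_of_Well_order] by (simp add: Field_card_of)

lemma card_of_UN_finite_ordLess:
  assumes "infinite X" and I: "|I| <o |X|" and fin: "\<And>i. i \<in> I \<Longrightarrow> finite (F i)"
  shows "|\<Union>i\<in>I. F i| <o |X|"
proof (cases "finite I")
  case True
  then show ?thesis
    using assms by (simp add: finite_card_of_ordLess)
next
  case False
  then have "|\<Union>i\<in>I. F i| \<le>o |I|"
    using fin by (intro card_of_UNION_ordLeq_infinite) (auto intro: ordLess_imp_ordLeq finite_card_of_ordLess card_of_mono1)
  then show ?thesis
    using I ordLeq_ordLess_trans by blast
qed

text \<open>Transfinite recursion along \<open>T\<close>: fewer than \<open>|X|\<close> stages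
  precede any given one and each has used up finitely many points, so \<open>avoid\<close> supplies
  a member of \<open>\<A> t\<close> free of all of them.\<close>

lemma disjoint_choice:
  fixes X :: "'a set" and T :: "'t set" and \<A> :: "'t \<Rightarrow> 'a set set"
  assumes X: "infinite X" and T: "|T| \<le>o |X|"
    and fin: "\<And>t a. t \<in> T \<Longrightarrow> a \<in> \<A> t \<Longrightarrow> finite a"
    and avoid: "\<And>t U. t \<in> T \<Longrightarrow> |U| <o |X| \<Longrightarrow> \<exists>a\<in>\<A> t. a \<inter> U = {}"
  obtains f where "\<And>t. t \<in> T \<Longrightarrow> f t \<in> \<A> t" "disjoint_family_on f T"
proof -
  \<comment> \<open>The cardinal \<open>|T|\<close> is itself a well-order of \<open>T\<close>, one
    whose proper initial segments are all smaller than \<open>T\<close>.\<close>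
  define r where "r = |T|"
  have r: "Card_order r" "Field r = T" "Well_order r"
    unfolding r_def using card_of_Card_order card_of_Well_order Field_card_of by metis+
  \<comment> \<open>The guard \<open>t \<in> T\<close> lets the recursion run over the whole type;
    off \<open>T\<close> any value will do.\<close>
  define Q where "Q = (\<lambda>f t a. t \<in> T \<longrightarrow> a \<in> \<A> t \<and> a \<inter> (\<Union>s\<in>underS r t. f s) = {})"
  have "\<exists>f. \<forall>t. Q f t (f t)"
  proof (rule dependent_wf_choice)
    show "wf (r - Id)"
      using r by (simp add: well_order_on_def)
  next
    fix f g :: "'t \<Rightarrow> 'a set" and t a
    assume "\<And>z. (z, t) \<in> r - Id \<Longrightarrow> f z = g z"
    then have "(\<Union>s\<in>underS r t. f s) = (\<Union>s\<in>underS r t. g s)"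
      by (auto simp: underS_def)
    then show "Q f t a = Q g t a"
      by (simp add: Q_def)
  next
    fix t and f :: "'t \<Rightarrow> 'a set"
    assume prev: "\<And>s. (s, t) \<in> r - Id \<Longrightarrow> Q f s (f s)"
    show "\<exists>a. Q f t a"
    proof (cases "t \<in> T")
      case True
      have "|underS r t| <o |X|"
        using card_of_underS[of r t] r True T ordLess_ordLeq_trans unfolding r_def by blast
      moreover have "finite (f s)" if "s \<in> underS r t" for s
      proof -
        have "s \<in> T" "(s, t) \<in> r - Id"
          using that r by (auto simp: underS_def Field_def)
        then show ?thesis
          using prev[of s] fin by (auto simp: Q_def)
      qed
      ultimately have "|\<Union>s\<in>underS r t. f s| <o |X|"
        using card_of_UN_finite_ordLess[OF X] by blast
      from avoid[OF True this] show ?thesis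
        by (auto simp: Q_def)
    qed (simp add: Q_def)
  qed
  then obtain f where f: "\<And>t. Q f t (f t)"
    by blast
  have "f s \<inter> f t = {}" if "s \<in> T" "t \<in> T" "s \<noteq> t" for s t
  proof -
    have "(s, t) \<in> r \<or> (t, s) \<in> r"
      using r that by (auto simp: well_order_on_def linear_order_on_def total_on_def)
    then show ?thesis
      using f[of s] f[of t] that by (auto simp: Q_def underS_def)
  qed
  then have "disjoint_family_on f T"
    by (simp add: disjoint_family_on_def)
  with f show thesis
    by (intro that[of f]) (auto simp: Q_def)
qed

text \<open>Each \<open>A\<close> in \<open>\<G>\<close> is a demand on every block of the
  partition. All demands on all blocks are met by one disjoint choice, so blocks do not compete for
  points.\<close>

lemma large_partition:
  assumes X: "infinite X" and I: "|I| \<le>o |X|" "I \<noteq> {}"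
    and G: "|\<G>| \<le>o |X|" "\<G> \<noteq> {}"
    and fin: "\<And>A a. A \<in> \<G> \<Longrightarrow> a \<in> A \<Longrightarrow> finite a \<and> a \<noteq> {} \<and> a \<subseteq> X"
    and avoid: "\<And>A U. A \<in> \<G> \<Longrightarrow> |U| <o |X| \<Longrightarrow> \<exists>a\<in>A. a \<inter> U = {}"
  shows "\<exists>B. disjoint_family_on B I \<and> (\<Union>i\<in>I. B i) = X \<and>
    (\<forall>i\<in>I. X \<lesssim> B i \<and> (\<forall>A\<in>\<G>. \<exists>a\<in>A. a \<subseteq> B i))"
proof -
  \<comment> \<open>The factor \<open>X\<close> repeats each demand on each block \<open>|X|\<close>
    times, which makes the blocks large; the index set still has size at most
    \<open>|X|\<close>.\<close>
  define T where "T = (\<G> \<times> I) \<times> X"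
  have "|T| \<le>o |X|"
    unfolding T_def using X I G
    by (intro card_of_Sigma_ordLeq_infinite ballI) (auto simp: card_of_mono1)
  from disjoint_choice[where \<A> = "\<lambda>t. fst (fst t)", OF X this]
  obtain f where f: "\<And>t. t \<in> T \<Longrightarrow> f t \<in> fst (fst t)" and disj: "disjoint_family_on f T"
    using fin avoid by (auto simp: T_def) metis
  obtain i0 where i0: "i0 \<in> I"
    using I by blast
  \<comment> \<open>\<open>g i\<close> gathers everything chosen for block \<open>i\<close>. Points
    never chosen all go to block \<open>i0\<close>, so that the blocks cover
    \<open>X\<close>.\<close>
  define g where "g = (\<lambda>i. \<Union>t\<in>(\<G> \<times> {i}) \<times> X. f t)"
  define B where "B = (\<lambda>i. g i \<union> (if i = i0 then X - (\<Union>j\<in>I. g j) else {}))"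
  have gX: "g i \<subseteq> X" if "i \<in> I" for i
  proof -
    have "f t \<subseteq> X" if "t \<in> T" for t
      using fin[OF _ f[OF that]] that by (auto simp: T_def)
    then show ?thesis
      using that by (auto simp: g_def T_def)
  qed
  have g_disj: "g i \<inter> g j = {}" if "i \<in> I" "j \<in> I" "i \<noteq> j" for i j
  proof -
    have "f s \<inter> f t = {}" if "s \<in> (\<G> \<times> {i}) \<times> X" "t \<in> (\<G> \<times> {j}) \<times> X" for s t
    proof -
      have "s \<in> T" "t \<in> T" "s \<noteq> t"
        using that \<open>i \<in> I\<close> \<open>j \<in> I\<close> \<open>i \<noteq> j\<close> by (auto simp: T_def)
      then show ?thesis
        using disj by (simp add: disjoint_family_on_def)
    qed
    then show ?thesis
      unfolding g_def by blast
  qed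
  have "B i \<inter> B j = {}" if "i \<in> I" "j \<in> I" "i \<noteq> j" for i j
    using g_disj[OF that] that by (auto simp: B_def)
  then have 1: "disjoint_family_on B I"
    by (simp add: disjoint_family_on_def)
  have 2: "(\<Union>i\<in>I. B i) = X"
  proof
    show "(\<Union>i\<in>I. B i) \<subseteq> X"
      using gX by (auto simp: B_def split: if_splits)
    show "X \<subseteq> (\<Union>i\<in>I. B i)"
    proof
      fix x
      assume "x \<in> X"
      then have "x \<in> B i0 \<or> (\<exists>i\<in>I. x \<in> g i)"
        by (auto simp: B_def)
      then show "x \<in> (\<Union>i\<in>I. B i)"
        using i0 by (auto simp: B_def)
    qed
  qed
  have 3: "X \<lesssim> B i" if i: "i \<in> I" for i
  proof -
    obtain A where A: "A \<in> \<G>"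
      using G by blast
    \<comment> \<open>One point from each of the sets chosen for \<open>A\<close> and
      \<open>i\<close>; their disjointness makes \<open>e\<close> injective.\<close>
    define e where "e = (\<lambda>x. SOME y. y \<in> f ((A, i), x))"
    have e: "e x \<in> f ((A, i), x)" if "x \<in> X" for x
    proof -
      have "f ((A, i), x) \<noteq> {}"
        using f[of "((A, i), x)"] fin[OF A] A i that by (auto simp: T_def)
      then show ?thesis
        unfolding e_def by (simp add: some_in_eq)
    qed
    have "inj_on e X"
    proof (rule inj_onI, rule ccontr)
      fix x y
      assume xy: "x \<in> X" "y \<in> X" "e x = e y" "x \<noteq> y"
      then have "f ((A, i), x) \<inter> f ((A, i), y) = {}"
        using disj A i by (auto simp: disjoint_family_on_def T_def)
      then show False
        using e[of x] e[of y] xy by auto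
    qed
    moreover have "e ` X \<subseteq> B i"
      using e A by (fastforce simp: B_def g_def)
    ultimately show ?thesis
      unfolding lepoll_def by blast
  qed
  have 4: "\<exists>a\<in>A. a \<subseteq> B i" if "i \<in> I" "A \<in> \<G>" for i A
  proof -
    obtain x where x: "x \<in> X"
      using X by (metis ex_in_conv finite.emptyI)
    then have "f ((A, i), x) \<in> A"
      using f[of "((A, i), x)"] that by (auto simp: T_def)
    moreover have "f ((A, i), x) \<subseteq> B i"
      using x that by (auto simp: B_def g_def)
    ultimately show ?thesis
      by blast
  qed
  show ?thesis
    using 1 2 3 4 by blast
qed

section \<open>Countable bases and the number of closed sets\<close>

lemma metrizable_separable_imp_second_countable:
  assumes "metrizable_space X" "separable_space X"
  shows "second_countable X"
proof -
  obtain M d where "Metric_space M d" and X: "X = Metric_space.mtopology M d"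
    using assms(1) by (auto simp: metrizable_space_def)
  interpret Metric_space M d by fact
  obtain D where D: "countable D" "D \<subseteq> M" "mtopology closure_of D = M"
    using assms(2) unfolding X separable_space_def by auto
  define \<B> where "\<B> = (\<lambda>(x, n). mball x (inverse (Suc n))) ` (D \<times> (UNIV :: nat set))"
  have "\<exists>V\<in>\<B>. x \<in> V \<and> V \<subseteq> U" if U: "openin mtopology U" "x \<in> U" for U x
  proof -
    obtain e where e: "e > 0" "mball x e \<subseteq> U" and x: "x \<in> M"
      using U unfolding openin_mtopology by blast
    \<comment> \<open>With radius below \<open>e / 2\<close>, a ball centred within that radius of
      \<open>x\<close> stays inside \<open>mball x e\<close>.\<close>
    obtain n where n: "inverse (Suc n) < e / 2"
      using e reals_Archimedean[of "e / 2"] by auto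
    have "x \<in> mtopology closure_of D"
      using D x by simp
    then have "\<forall>r>0. \<exists>y\<in>D. y \<in> mball x r"
      unfolding metric_closure_of by blast
    moreover have "inverse (Suc n) > (0 :: real)"
      by simp
    ultimately obtain y where y: "y \<in> D" "y \<in> mball x (inverse (Suc n))"
      by blast
    have "mball y (inverse (Suc n)) \<subseteq> mball x e"
    proof
      fix z
      assume z: "z \<in> mball y (inverse (Suc n))"
      then have "d x z \<le> d x y + d y z"
        using x y by (intro triangle) auto
      moreover have "d x y < e / 2" "d y z < e / 2"
        using y z n by auto
      ultimately show "z \<in> mball x e"
        using x z by simp
    qed
    then have "mball y (inverse (Suc n)) \<subseteq> U"
      using e by blast
    moreover have "x \<in> mball y (inverse (Suc n))"
      using y by (simp add: commute)
    moreover have "mball y (inverse (Suc n)) \<in> \<B>"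
      unfolding \<B>_def using y(1) by (intro image_eqI[of _ _ "(y, n)"]) simp_all
    ultimately show ?thesis
      by blast
  qed
  moreover have "countable \<B>" "\<forall>V\<in>\<B>. openin mtopology V"
    using D by (auto simp: \<B>_def)
  ultimately show ?thesis
    unfolding second_countable_def X by blast
qed

lemma second_countable_prod_topology:
  assumes "second_countable X" "second_countable Y"
  shows "second_countable (prod_topology X Y)"
proof -
  obtain \<B> where B: "countable \<B>" "\<forall>V\<in>\<B>. openin X V"
    "\<forall>U x. openin X U \<and> x \<in> U \<longrightarrow> (\<exists>V\<in>\<B>. x \<in> V \<and> V \<subseteq> U)"
    using assms(1) unfolding second_countable_def by blast
  obtain \<C> where C: "countable \<C>" "\<forall>V\<in>\<C>. openin Y V"
    "\<forall>U x. openin Y U \<and> x \<in> U \<longrightarrow> (\<exists>V\<in>\<C>. x \<in> V \<and> V \<subseteq> U)"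
    using assms(2) unfolding second_countable_def by blast
  show ?thesis
    unfolding second_countable_def
  proof (intro exI[of _ "(\<lambda>(U, V). U \<times> V) ` (\<B> \<times> \<C>)"] conjI allI impI)
    fix W p
    assume W: "openin (prod_topology X Y) W \<and> p \<in> W"
    obtain x y where p: "p = (x, y)"
      by fastforce
    obtain U V where "openin X U" "openin Y V" "x \<in> U" "y \<in> V" and UV: "U \<times> V \<subseteq> W"
      using W unfolding p openin_prod_topology_alt by blast
    then obtain U' V' where "U' \<in> \<B>" "x \<in> U'" "U' \<subseteq> U" "V' \<in> \<C>" "y \<in> V'" "V' \<subseteq> V"
      using B(3) C(3) by meson
    with UV show "\<exists>V\<in>(\<lambda>(U, V). U \<times> V) ` (\<B> \<times> \<C>). p \<in> V \<and> V \<subseteq> W"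
      unfolding p by (intro bexI[of _ "U' \<times> V'"]) auto
  qed (use B C in \<open>auto simp: openin_prod_Times_iff\<close>)
qed

text \<open>The basic open sets missing a closed set exhaust its complement, so they determine it
  and code it by a set of naturals.\<close>

lemma second_countable_closedin_lepoll:
  assumes "second_countable X"
  shows "{C. closedin X C} \<lesssim> (UNIV :: real set)"
proof -
  obtain \<B> where B: "countable \<B>" "\<forall>V\<in>\<B>. openin X V"
    "\<forall>U x. openin X U \<and> x \<in> U \<longrightarrow> (\<exists>V\<in>\<B>. x \<in> V \<and> V \<subseteq> U)"
    using assms unfolding second_countable_def by blast
  define N where "N = (\<lambda>C. to_nat_on \<B> ` {V \<in> \<B>. V \<inter> C = {}})"
  have *: "C \<subseteq> D" if "closedin X C" "closedin X D" "N C = N D" for C D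
  proof
    fix x
    assume x: "x \<in> C"
    show "x \<in> D"
    proof (rule ccontr)
      assume "x \<notin> D"
      then have "x \<in> topspace X - D" "openin X (topspace X - D)"
        using that x closedin_subset by (auto simp: closedin_def)
      from B(3)[rule_format, OF conjI[OF this(2,1)]] obtain V where V: "V \<in> \<B>" "x \<in> V" "V \<inter> D = {}"
        by blast
      have "{V \<in> \<B>. V \<inter> C = {}} = {V \<in> \<B>. V \<inter> D = {}}"
        using that(3) inj_on_to_nat_on[OF B(1)] unfolding N_def
        by (subst (asm) inj_on_image_eq_iff) auto
      then show False
        using V x by blast
    qed
  qed
  have "inj_on N {C. closedin X C}"
    using * by (intro inj_onI) (metis mem_Collect_eq subset_antisym)
  then have "{C. closedin X C} \<lesssim> (UNIV :: nat set set)"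
    unfolding lepoll_def by blast
  also have "\<dots> \<approx> (UNIV :: real set)"
    by (rule nat_sets_eqpoll_reals)
  finally show ?thesis .
qed

section \<open>Sizes of Polish spaces and of Cantor sets\<close>

text \<open>The Cantor-Bendixson argument: deleting all countable members of a countable base
  removes only countably many points and leaves a nonempty perfect set.\<close>

lemma reals_lepoll_uncountable_Polish:
  assumes X: "completely_metrizable_space X" "second_countable X" and unc: "uncountable (topspace X)"
  shows "(UNIV :: real set) \<lesssim> topspace X"
proof -
  obtain \<B> where B: "countable \<B>" "\<forall>V\<in>\<B>. openin X V"
    "\<forall>U x. openin X U \<and> x \<in> U \<longrightarrow> (\<exists>V\<in>\<B>. x \<in> V \<and> V \<subseteq> U)"
    using X(2) unfolding second_countable_def by blast
  define N where "N = \<Union>{V \<in> \<B>. countable V}"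
  define S where "S = topspace X - N"
  have "countable {V \<in> \<B>. countable V}"
    using B(1) by (rule countable_subset[rotated]) auto
  then have N: "countable N"
    unfolding N_def using countable_UN[of _ "\<lambda>V. V"] by auto
  have "closedin X S"
    unfolding S_def N_def using B(2) by (intro closedin_diff openin_Union) auto
  then have "X derived_set_of S \<subseteq> S"
    by (simp add: closedin_contains_derived_set)
  moreover have "S \<subseteq> X derived_set_of S"
  proof
    fix x
    assume x: "x \<in> S"
    have "\<exists>y. y \<noteq> x \<and> y \<in> S \<and> y \<in> U" if U: "x \<in> U" "openin X U" for U
    proof -
      obtain V where V: "V \<in> \<B>" "x \<in> V" "V \<subseteq> U"
        using B(3) U by blast
      then have "uncountable V"
        using x by (auto simp: S_def N_def)
      \<comment> \<open>Discarding \<open>x\<close> along with \<open>N\<close> yields another point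
        of \<open>S\<close> in \<open>V\<close>, so \<open>x\<close> is a limit point.\<close>
      then have "uncountable (V - insert x N)"
        using N by (simp add: uncountable_minus_countable)
      then obtain y where "y \<in> V - insert x N"
        by (metis countable_empty ex_in_conv)
      then show ?thesis
        using V U openin_subset[OF U(2)] by (auto simp: S_def)
    qed
    then show "x \<in> X derived_set_of S"
      using x by (auto simp: in_derived_set_of S_def)
  qed
  moreover have "S \<noteq> {}"
    using unc uncountable_minus_countable[OF unc N] unfolding S_def by force
  ultimately have "(UNIV :: real set) \<lesssim> S"
    using lepoll_perfect_set X(1) by blast
  also have "S \<lesssim> topspace X"
    by (simp add: S_def subset_imp_lepoll)
  finally show ?thesis .
qed

text \<open>Without open singletons the whole space is perfect, and it falls under the locally
  compact Hausdorff case of \<open>lepoll_perfect_set\<close>.\<close>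

lemma reals_lepoll_cantor_space:
  assumes "cantor_space X"
  shows "(UNIV :: real set) \<lesssim> topspace X"
proof (rule lepoll_perfect_set)
  show "completely_metrizable_space X \<or> locally_compact_space X \<and> Hausdorff_space X"
    using assms compact_imp_locally_compact_space metrizable_imp_Hausdorff_space
    by (auto simp: cantor_space_def)
  show "X derived_set_of topspace X = topspace X" "topspace X \<noteq> {}"
    using assms by (auto simp: derived_set_of_topspace cantor_space_def)
qed

section \<open>Closures of graphs\<close>

text \<open>The graph of a continuous map into a Hausdorff space is closed in
  \<open>B \<times> topspace Y\<close>, and closure in that subspace is the trace of the full
  closure. New values can thus appear only over points outside \<open>B\<close>.\<close>

lemma closure_of_graph_unique:
  assumes h: "continuous_map (subtopology X B) Y h" and Y: "Hausdorff_space Y"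
    and B: "B \<subseteq> topspace X" "x \<in> B"
  shows "(x, y) \<in> prod_topology X Y closure_of ((\<lambda>x. (x, h x)) ` B) \<longleftrightarrow> y = h x"
proof -
  let ?G = "(\<lambda>x. (x, h x)) ` B"
  have top: "topspace (subtopology X B) = B"
    using B by auto
  have hY: "h z \<in> topspace Y" if "z \<in> B" for z
    using h that top continuous_map_image_subset_topspace by blast
  have "closedin (prod_topology (subtopology X B) Y) ?G"
    using continuous_map_imp_closed_graph[OF h Y] by (simp only: top)
  then have "?G = prod_topology (subtopology X B) Y closure_of ?G"
    by (simp add: closure_of_closedin)
  also have "\<dots> = (B \<times> topspace Y) \<inter> (prod_topology X Y closure_of ?G)"
    using hY by (simp add: prod_topology_subtopology closure_of_subtopology Int_absorb1 image_subset_iff)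
  finally have eq: "?G = (B \<times> topspace Y) \<inter> (prod_topology X Y closure_of ?G)" .
  have "prod_topology X Y closure_of ?G \<subseteq> topspace X \<times> topspace Y"
    using closure_of_subset_topspace[of "prod_topology X Y"] by simp
  then have "(x, y) \<in> prod_topology X Y closure_of ?G \<longleftrightarrow> (x, y) \<in> ?G"
    using eq B by blast
  then show ?thesis
    using B by auto
qed

text \<open>Only the points where the relation is single-valued count: these include the domain of
  the embedding whose graph closure is \<open>K\<close>.\<close>

definition function_pairs :: "('a \<times> 'a) set \<Rightarrow> 'a set set" where
  "function_pairs K = {{x, y} | x y. K `` {x} = {y}}"

section \<open>Construction and properties of the partition\<close>

theorem theorem6:
  fixes \<kappa> :: "'k rel" and P :: "'a topology"
  assumes "Card_order \<kappa>"
    and "ctwo \<le>o \<kappa>"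
    and "\<kappa> \<le>o ctwo ^c natLeq"
    and "polish_topology P"
    and "uncountable (topspace P)"
  shows "\<exists>\<B>. partition_on (topspace P) \<B> \<and> |\<B>| =o \<kappa> \<and>
    (\<forall>B\<in>\<B>. bernstein_set P B) \<and>
    (\<forall>B\<in>\<B>. \<not> (\<exists>S. S \<subseteq> topspace P - B \<and>
      subtopology P B homeomorphic_space subtopology P S))"
proof -
  define X where "X = topspace P"
  define I where "I = Field \<kappa>"
  have P: "completely_metrizable_space P" "metrizable_space P" "Hausdorff_space P" "second_countable P"
    using assms(4) completely_metrizable_imp_metrizable_space metrizable_imp_Hausdorff_space
      metrizable_separable_imp_second_countable by (auto simp: polish_topology_def)
  have infX: "infinite X" and RX: "(UNIV :: real set) \<lesssim> X"
    using assms(5) P reals_lepoll_uncountable_Polish countable_finite by (auto simp: X_def)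
  have I: "|I| =o \<kappa>"
    using assms(1) by (simp add: I_def card_of_Field_ordIso)
  \<comment> \<open>The upper bound on \<open>\<kappa>\<close> is the size of the power set of the
    naturals, hence of the reals, which inject into \<open>X\<close>.\<close>
  have "ctwo ^c natLeq =o |UNIV :: nat set set|"
    using card_of_Pow_Func[of "UNIV :: nat set"] ordIso_symmetric
    by (auto simp: cexp_def ctwo_def Field_natLeq Field_card_of)
  then have "|I| \<le>o |UNIV :: nat set set|"
    using I assms(3) by (meson ordIso_ordLeq_trans ordLeq_ordIso_trans)
  then have IX: "|I| \<le>o |X|"
    using RX nat_sets_eqpoll_reals
    by (metis eqpoll_imp_lepoll lepoll_iff_card_of_ordLeq lepoll_trans)
  \<comment> \<open>The lower bound on \<open>\<kappa>\<close> gives a second index beside any given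
    one; its block will keep Cantor sets from lying inside a single block.\<close>
  have "|UNIV :: bool set| \<le>o |I|"
    using assms(2) I unfolding ctwo_def by (meson ordIso_symmetric ordLeq_ordIso_trans)
  then obtain b :: "bool \<Rightarrow> 'k" where b: "inj b" "range b \<subseteq> I"
    by (auto simp flip: card_of_ordLeq)
  have other: "\<exists>j\<in>I. j \<noteq> i" for i
    using b by (metis injD range_subsetD)
  then have "I \<noteq> {}"
    by blast

  define \<G>0 where "\<G>0 = (\<lambda>C. (\<lambda>x. {x}) ` C) ` {C. closedin P C}
    \<union> function_pairs ` {K. closedin (prod_topology P P) K}"
  \<comment> \<open>This filter makes the hypothesis \<open>avoid\<close> of
    \<open>large_partition\<close> hold by definition. That the demands used later survive it is
    shown in \<open>singles\<close> and in \<open>no_embedding\<close>.\<close>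
  define \<G> where "\<G> = {A \<in> \<G>0. \<forall>U. |U| <o |X| \<longrightarrow> (\<exists>a\<in>A. a \<inter> U = {})}"
  have small: "|f ` {C. closedin Y C}| \<le>o |X|" if "second_countable Y" for f :: "'b set \<Rightarrow> 'a set set" and Y
    using lepoll_trans[OF image_lepoll lepoll_trans[OF second_countable_closedin_lepoll[OF that] RX]]
    by (simp add: lepoll_iff_card_of_ordLeq)
  have "|\<G>0| \<le>o |X|"
    unfolding \<G>0_def using infX P
    by (intro card_of_Un_ordLeq_infinite_Field small second_countable_prod_topology) (simp_all add: Field_card_of card_of_card_order_on)
  then have G: "|\<G>| \<le>o |X|"
    using card_of_mono1[of \<G> \<G>0] ordLeq_transitive by (auto simp: \<G>_def)
  have escape: "\<exists>x\<in>C. x \<notin> U" if "X \<lesssim> C" "|U| <o |X|" for C U :: "'a set"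
    using that by (metis lepoll_iff_card_of_ordLeq card_of_mono1 not_ordLess_ordLeq ordLeq_transitive subsetI)
  have singles: "(\<lambda>x. {x}) ` C \<in> \<G>" if "closedin P C" "X \<lesssim> C" for C
    using that escape by (auto simp: \<G>_def \<G>0_def)
  have "\<G> \<noteq> {}"
    using singles[of X] by (auto simp: X_def)
  have fin: "finite a \<and> a \<noteq> {} \<and> a \<subseteq> X" if a: "A \<in> \<G>" "a \<in> A" for A a
  proof -
    consider C x where "closedin P C" "x \<in> C" "a = {x}"
      | K x y where "closedin (prod_topology P P) K" "K `` {x} = {y}" "a = {x, y}"
      using a by (auto simp: \<G>_def \<G>0_def function_pairs_def)
    then show ?thesis
    proof cases
      case 1
      then show ?thesis
        using closedin_subset by (auto simp: X_def)
    next
      case 2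
      then have "(x, y) \<in> X \<times> X"
        using closedin_subset[of "prod_topology P P" K] by (auto simp: X_def)
      with 2 show ?thesis
        by auto
    qed
  qed
  have avoid: "\<exists>a\<in>A. a \<inter> U = {}" if "A \<in> \<G>" "|U| <o |X|" for A U
    using that by (simp add: \<G>_def)
  have ex: "\<exists>B. disjoint_family_on B I \<and> (\<Union>i\<in>I. B i) = X \<and>
    (\<forall>i\<in>I. X \<lesssim> B i \<and> (\<forall>A\<in>\<G>. \<exists>a\<in>A. a \<subseteq> B i))"
    by (rule large_partition[OF infX IX \<open>I \<noteq> {}\<close> G \<open>\<G> \<noteq> {}\<close>]) (use fin avoid in auto)
  obtain B where B: "disjoint_family_on B I" "(\<Union>i\<in>I. B i) = X"
    "\<And>i. i \<in> I \<Longrightarrow> X \<lesssim> B i" "\<And>i A. i \<in> I \<Longrightarrow> A \<in> \<G> \<Longrightarrow> \<exists>a\<in>A. a \<subseteq> B i"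
    using ex by metis
  have BX: "B i \<subseteq> X" if "i \<in> I" for i
    using B(2) that by blast
  have ne: "B i \<noteq> {}" if "i \<in> I" for i
    using B(3)[OF that] infX by (auto simp: lepoll_empty_iff_empty)
  have disj: "B i \<inter> B j = {}" if "i \<in> I" "j \<in> I" "i \<noteq> j" for i j
    using B(1) that by (auto simp: disjoint_family_on_def)

  have meets: "C \<inter> B i \<noteq> {}" if C: "cantor_subset P C" and i: "i \<in> I" for C i
  proof -
    have "C \<subseteq> X" "cantor_space (subtopology P C)" and top: "topspace (subtopology P C) = C"
      using C by (auto simp: cantor_subset_def X_def)
    then have "(UNIV :: real set) \<lesssim> C" "compactin P C"
      using reals_lepoll_cantor_space[of "subtopology P C"]
      by (auto simp: cantor_space_def compactin_subspace X_def)
    then have "closedin P C"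
      using P compactin_imp_closedin by blast
    \<comment> \<open>Points give closed singletons, so \<open>X\<close> has at most continuum many
      points and \<open>C\<close> is as large as \<open>X\<close>; the demand of \<open>C\<close>
      therefore lies in \<open>\<G>\<close>.\<close>
    have "X \<lesssim> (\<lambda>x. {x}) ` X"
      by (simp add: inj_on_image_lepoll_2)
    also have "\<dots> \<lesssim> {C. closedin P C}"
      using P by (intro subset_imp_lepoll) (auto simp: X_def closedin_Hausdorff_singleton)
    also have "\<dots> \<lesssim> (UNIV :: real set)"
      using P second_countable_closedin_lepoll by blast
    also have "\<dots> \<lesssim> C" by fact
    finally show ?thesis
      using B(4)[OF i singles[OF \<open>closedin P C\<close>]] by auto
  qed
  have bernstein: "bernstein_set P (B i)" if i: "i \<in> I" for i
  proof -
    have "\<not> C \<subseteq> B i" "\<not> C \<subseteq> topspace P - B i" if C: "cantor_subset P C" for C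
    proof -
      obtain j where "j \<in> I" "j \<noteq> i"
        using other by blast
      then show "\<not> C \<subseteq> B i"
        using meets[OF C, of j] disj[of i j] i by blast
      show "\<not> C \<subseteq> topspace P - B i"
        using meets[OF C i] by blast
    qed
    then show ?thesis
      using BX[OF i] by (auto simp: bernstein_set_def X_def)
  qed
  have no_embedding: False
    if i: "i \<in> I" and S: "S \<subseteq> topspace P - B i"
      and hom: "subtopology P (B i) homeomorphic_space subtopology P S" for i S
  proof -
    have Bi: "B i \<subseteq> topspace P"
      using BX[OF i] by (simp add: X_def)
    obtain h where "homeomorphic_map (subtopology P (B i)) (subtopology P S) h"
      using hom homeomorphic_space by blast
    then have cont: "continuous_map (subtopology P (B i)) P h" and inj: "inj_on h (B i)"
      and him: "h ` B i \<subseteq> S"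
      using Bi S homeomorphic_imp_continuous_map[of "subtopology P (B i)" "subtopology P S" h]
        homeomorphic_imp_injective_map[of "subtopology P (B i)" "subtopology P S" h]
      by (auto simp: continuous_map_in_subtopology Int_absorb1)
    \<comment> \<open>The closed relation through which \<open>h\<close> took part in the recursion,
      although \<open>B\<close> was not yet known there.\<close>
    define K where "K = prod_topology P P closure_of ((\<lambda>x. (x, h x)) ` B i)"
    have K: "(x, y) \<in> K \<longleftrightarrow> y = h x" if "x \<in> B i" for x y
      unfolding K_def by (rule closure_of_graph_unique[OF cont P(3) Bi that])
    have "\<exists>a\<in>function_pairs K. a \<inter> U = {}" if U: "|U| <o |X|" for U
    proof -
      \<comment> \<open>Injectivity of \<open>h\<close> keeps the preimage of a small set small,
        while \<open>B i\<close> is as large as \<open>X\<close>; so some \<open>x\<close> in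
        \<open>B i\<close> lies outside \<open>U\<close> together with \<open>h x\<close>.\<close>
      have "h -` U \<inter> B i \<lesssim> U"
        unfolding lepoll_def using inj by (intro exI[of _ h]) (auto intro: inj_on_subset)
      then have "|h -` U \<inter> B i| <o |X|"
        using U by (meson lepoll_iff_card_of_ordLeq ordLeq_ordLess_trans)
      then have "|U \<union> (h -` U \<inter> B i)| <o |X|"
        using U infX card_of_Un_ordLess_infinite by blast
      then obtain x where "x \<in> B i" "x \<notin> U" "h x \<notin> U"
        using escape[OF B(3)[OF i], of "U \<union> (h -` U \<inter> B i)"] by blast
      moreover have "K `` {x} = {h x}"
        using K \<open>x \<in> B i\<close> by auto
      ultimately show ?thesis
        unfolding function_pairs_def by (intro bexI[of _ "{x, h x}"]) auto
    qed
    moreover have "function_pairs K \<in> \<G>0"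
      unfolding \<G>0_def by (rule UnI2, rule imageI) (simp add: K_def)
    ultimately have "function_pairs K \<in> \<G>"
      by (simp add: \<G>_def)
    \<comment> \<open>As \<open>x\<close> lies in \<open>B i\<close>, its only
      \<open>K\<close>-value \<open>y\<close> is \<open>h x\<close>. Thus \<open>h x\<close> lies in
      \<open>B i\<close>, but also in \<open>S\<close>, which is disjoint from
      \<open>B i\<close>.\<close>
    from B(4)[OF i this] obtain x y where "{x, y} \<subseteq> B i" "K `` {x} = {y}"
      unfolding function_pairs_def by blast
    then have "h x \<in> B i"
      using K[of x "h x"] by auto
    then show False
      using him S \<open>{x, y} \<subseteq> B i\<close> by auto
  qed
  \<comment> \<open>Nonempty disjoint blocks are distinct, so no cardinality is lost in passing from
    indices to blocks.\<close>
  have "inj_on B I"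
    using disj ne by (intro inj_onI) (metis Int_absorb)
  then have "|B ` I| =o |I|"
    by (metis card_of_ordIsoI inj_on_imp_bij_betw ordIso_symmetric)
  then have "|B ` I| =o \<kappa>"
    using I ordIso_transitive by blast
  moreover have "partition_on (topspace P) (B ` I)"
  proof (rule partition_onI)
    show "\<Union>(B ` I) = topspace P"
      using B(2) by (simp add: X_def)
    show "disjnt p q" if "p \<in> B ` I" "q \<in> B ` I" "p \<noteq> q" for p q
      using that disj unfolding disjnt_def by blast
    show "{} \<notin> B ` I"
      using ne by force
  qed
  ultimately show ?thesis
    using bernstein no_embedding by (intro exI[of _ "B ` I"]) blast
qed

end
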